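(* Let $\mathfrak{g}=A_{5,3}$ and let $\langle\cdot,\cdot\rangle$ be an inner product on $\mathfrak{g}$. Let $\eta>0$ and let $\{v_1,\dots,v_5\}$ be a basis of $\mathfrak{g}$, orthonormal with respect to $\eta\langle\cdot,\cdot\rangle$, whose only nonzero brackets (up to antisymmetry) are $[v_1,v_2]=\alpha v_3+\beta v_4$, $[v_1,v_3]=\gamma v_4+\delta v_5$, $[v_2,v_3]=\varepsilon v_5$, with $\alpha,\gamma,\varepsilon>0$ and $\beta,\delta\in\mathbb{R}$. Then $\langle\cdot,\cdot\rangle$ is a nilsoliton if and only if $\beta=\delta=0$ and $\varepsilon=\gamma=\frac{\sqrt{3}}{2}\alpha$.
   Context: $A_{5,3}$ is the five-dimensional real nilpotent Lie algebra having a basis with the brackets displayed in the claim. An inner product on $\mathfrak{g}$ is identified with the left-invariant Riemannian metric $g$ it induces on the simply connected Lie group $G$ with Lie algebra $\mathfrak{g}$. Let $ric_g$ be the Ricci curvature tensor of $(G,g)$ (Levi-Civita connection), viewed as a symmetric bilinear form on $\mathfrak{g}$; since $\mathfrak{g}$ is nilpotent, $ric_g(u,v)=-\frac12\mathrm{tr}(ad_u\circ ad_v^* )-\frac14\mathrm{tr}(J_u\circ J_v)$, where $ad_uv=[u,v]$, $ad_v^*$ is the $g$-transpose of $ad_v$, and $J_uv=ad_v^*u$. The Ricci operator $Ric_g$ is defined by $ric_g(u,v)=g(Ric_g(u),v)$. The metric $g$ is a nilsoliton if $Ric_g\in\mathbb{R}\,\mathrm{Id}_{\mathfrak{g}}\oplus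 Der(\mathfrak{g})$, i.e. $Ric_g=c\,\mathrm{Id}+D$ for some $c\in\mathbb{R}$ and some derivation $D$ of $\mathfrak{g}$. *)

theory Defs
  imports "HOL-Analysis.Analysis"
begin

text \<open>
  A real Lie algebra is a type \<open>'a :: real_vector\<close> together with a bracket; finite
  dimensionality is never built into the type, and comes from the existence of a basis.
\<close>

definition lie_algebra :: "('a::real_vector \<Rightarrow> 'a \<Rightarrow> 'a) \<Rightarrow> bool" where
  "lie_algebra br \<longleftrightarrow> bilinear br \<and> (\<forall>x. br x x = 0) \<and>
     (\<forall>x y z. br x (br y z) + br y (br z x) + br z (br x y) = 0)"

definition lie_derivation :: "('a::real_vector \<Rightarrow> 'a \<Rightarrow> 'a) \<Rightarrow> ('a \<Rightarrow> 'a) \<Rightarrow> bool" where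
  "lie_derivation br D \<longleftrightarrow> linear D \<and> (\<forall>x y. D (br x y) = br (D x) y + br x (D y))"

definition inner_product :: "('a::real_vector \<Rightarrow> 'a \<Rightarrow> real) \<Rightarrow> bool" where
  "inner_product g \<longleftrightarrow> bilinear g \<and> (\<forall>x y. g x y = g y x) \<and> (\<forall>x. x \<noteq> 0 \<longrightarrow> g x x > 0)"

definition is_basis5 :: "(nat \<Rightarrow> 'a::real_vector) \<Rightarrow> bool" where
  "is_basis5 v \<longleftrightarrow> inj_on v {1..5} \<and> independent (v ` {1..5}) \<and> span (v ` {1..5}) = UNIV"

definition orthonormal5 :: "('a::real_vector \<Rightarrow> 'a \<Rightarrow> real) \<Rightarrow> (nat \<Rightarrow> 'a) \<Rightarrow> bool" where
  "orthonormal5 g v \<longleftrightarrow> (\<forall>i\<in>{1..5}. \<forall>j\<in>{1..5}. g (v i) (v j) = (if i = j then 1 else 0))"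

definition A53_brackets ::
  "('a::real_vector \<Rightarrow> 'a \<Rightarrow> 'a) \<Rightarrow> (nat \<Rightarrow> 'a) \<Rightarrow> real \<Rightarrow> real \<Rightarrow> real \<Rightarrow> real \<Rightarrow> real \<Rightarrow> bool"
where
  "A53_brackets br v \<alpha> \<beta> \<gamma> \<delta> \<epsilon> \<longleftrightarrow>
     br (v 1) (v 2) = \<alpha> *\<^sub>R v 3 + \<beta> *\<^sub>R v 4 \<and>
     br (v 1) (v 3) = \<gamma> *\<^sub>R v 4 + \<delta> *\<^sub>R v 5 \<and>
     br (v 2) (v 3) = \<epsilon> *\<^sub>R v 5 \<and>
     br (v 1) (v 4) = 0 \<and> br (v 1) (v 5) = 0 \<and>
     br (v 2) (v 4) = 0 \<and> br (v 2) (v 5) = 0 \<and>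
     br (v 3) (v 4) = 0 \<and> br (v 3) (v 5) = 0 \<and>
     br (v 4) (v 5) = 0"

text \<open>
  The Lie algebras isomorphic to \<open>A\<^sub>5\<^sub>,\<^sub>3\<close>.  All parameter values with
  \<open>\<alpha>, \<gamma>, \<epsilon> > 0\<close> give one isomorphism class: \<open>e\<^sub>1 = v\<^sub>1\<close>, \<open>e\<^sub>2 = v\<^sub>2\<close>, \<open>e\<^sub>3 = [e\<^sub>1, e\<^sub>2]\<close>,
  \<open>e\<^sub>4 = [e\<^sub>1, e\<^sub>3]\<close>, \<open>e\<^sub>5 = [e\<^sub>2, e\<^sub>3]\<close> is a basis satisfying the relations with
  parameters \<open>1, 0, 1, 0, 1\<close>.  Nilpotency is automatic.
\<close>
definition is_A53 :: "('a::real_vector \<Rightarrow> 'a \<Rightarrow> 'a) \<Rightarrow> bool" where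
  "is_A53 br \<longleftrightarrow> lie_algebra br \<and>
     (\<exists>v \<alpha> \<beta> \<gamma> \<delta> \<epsilon>. is_basis5 v \<and> \<alpha> > 0 \<and> \<gamma> > 0 \<and> \<epsilon> > 0 \<and> A53_brackets br v \<alpha> \<beta> \<gamma> \<delta> \<epsilon>)"

text \<open>
  Trace of an endomorphism of a finite-dimensional space, computed in the basis
  \<open>real_vector.extend_basis {}\<close> of the whole space; the choice of basis is immaterial.
\<close>
definition lin_trace :: "('a::real_vector \<Rightarrow> 'a) \<Rightarrow> real" where
  "lin_trace f = (\<Sum>b\<in>real_vector.extend_basis {}. real_vector.representation (real_vector.extend_basis {}) (f b) b)"

text \<open>
  Riemannian geometry of the left-invariant metric induced by \<open>g\<close> on the simply connected Lie
  group, expressed on left-invariant vector fields.  Covariant derivatives of left-invariant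
  fields along left-invariant fields are left-invariant, so the Levi-Civita connection is a
  bilinear product on the Lie algebra.  It is the unique one that is torsion-free and metric
  (functions \<open>g(X, Y)\<close> of left-invariant fields are constant, hence the form of the metric
  condition).
\<close>
definition levi_civita ::
  "('a::real_vector \<Rightarrow> 'a \<Rightarrow> 'a) \<Rightarrow> ('a \<Rightarrow> 'a \<Rightarrow> real) \<Rightarrow> 'a \<Rightarrow> 'a \<Rightarrow> 'a" where
  "levi_civita br g = (THE nab. bilinear nab \<and>
     (\<forall>u v. nab u v - nab v u = br u v) \<and>
     (\<forall>u v w. g (nab u v) w + g v (nab u w) = 0))"

definition riemann ::
  "('a::real_vector \<Rightarrow> 'a \<Rightarrow> 'a) \<Rightarrow> ('a \<Rightarrow> 'a \<Rightarrow> real) \<Rightarrow> 'a \<Rightarrow> 'a \<Rightarrow> 'a \<Rightarrow> 'a" where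
  "riemann br g u v w =
     (let nab = levi_civita br g in nab u (nab v w) - nab v (nab u w) - nab (br u v) w)"

text \<open>
  With this order of arguments round spheres have positive Ricci curvature.  For nilpotent Lie
  algebras the tensor equals
  \<open>- tr (ad\<^sub>u \<circ> ad\<^sub>v\<^sup>*) / 2 - tr (J\<^sub>u \<circ> J\<^sub>v) / 4\<close>, where \<open>J\<^sub>u v = ad\<^sub>v\<^sup>* u\<close>.
\<close>
definition ricci ::
  "('a::real_vector \<Rightarrow> 'a \<Rightarrow> 'a) \<Rightarrow> ('a \<Rightarrow> 'a \<Rightarrow> real) \<Rightarrow> 'a \<Rightarrow> 'a \<Rightarrow> real" where
  "ricci br g u v = lin_trace (\<lambda>w. riemann br g w u v)"

definition ricci_operator ::
  "('a::real_vector \<Rightarrow> 'a \<Rightarrow> 'a) \<Rightarrow> ('a \<Rightarrow> 'a \<Rightarrow> real) \<Rightarrow> 'a \<Rightarrow> 'a" where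
  "ricci_operator br g u = (THE w. \<forall>v. ricci br g u v = g w v)"

definition nilsoliton :: "('a::real_vector \<Rightarrow> 'a \<Rightarrow> 'a) \<Rightarrow> ('a \<Rightarrow> 'a \<Rightarrow> real) \<Rightarrow> bool" where
  "nilsoliton br g \<longleftrightarrow>
     (\<exists>c D. lie_derivation br D \<and> (\<forall>u. ricci_operator br g u = c *\<^sub>R u + D u))"

end

theory Submission
  imports Defs
begin

text \<open>
  Rescaling the metric rescales the Ricci operator, so the metric may be replaced by
  \<open>h = \<eta>\<langle>\<cdot>,\<cdot>\<rangle>\<close>, for which \<open>v\<^sub>1, \<dots>, v\<^sub>5\<close> is orthonormal; Koszul's formula then gives the Ricci
  operator in this basis.  Let \<open>D = Ric - c Id\<close> be a derivation.  The \<open>v\<^sub>4\<close>-component of its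
  Leibniz rule on \<open>[v\<^sub>1, v\<^sub>4] = 0\<close> forces \<open>\<beta> = 0\<close>, the one on \<open>[v\<^sub>2, v\<^sub>3]\<close> forces \<open>\<delta> = 0\<close>.  Now \<open>D\<close> is
  diagonal, and the weights must satisfy \<open>d\<^sub>3 = d\<^sub>1 + d\<^sub>2\<close>, \<open>d\<^sub>4 = d\<^sub>1 + d\<^sub>3\<close>, \<open>d\<^sub>5 = d\<^sub>2 + d\<^sub>3\<close>, i.e.
  \<open>c = -3\<alpha>\<^sup>2/2\<close> and \<open>3\<gamma>\<^sup>2 + \<epsilon>\<^sup>2 = 3\<alpha>\<^sup>2 = \<gamma>\<^sup>2 + 3\<epsilon>\<^sup>2\<close>.
\<close>

section \<open>Linear algebra in a finite orthonormal frame\<close>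

locale orthonormal_frame =
  fixes h :: "'a::real_vector \<Rightarrow> 'a \<Rightarrow> real" and E :: "'a set"
  assumes inner: "inner_product h"
    and finite_E: "finite E"
    and span_E: "span E = UNIV"
    and orthonormal: "\<And>e f. e \<in> E \<Longrightarrow> f \<in> E \<Longrightarrow> h e f = (if e = f then 1 else 0)"
begin

lemma bilinear_h: "bilinear h"
  using inner by (simp add: inner_product_def)

lemma h_commute: "h x y = h y x"
  using inner by (simp add: inner_product_def)

lemmas h_simps =
  bilinear_ladd[OF bilinear_h] bilinear_radd[OF bilinear_h]
  bilinear_lmul[OF bilinear_h] bilinear_rmul[OF bilinear_h]
  bilinear_lneg[OF bilinear_h] bilinear_rneg[OF bilinear_h]
  bilinear_lzero[OF bilinear_h] bilinear_rzero[OF bilinear_h]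
  bilinear_lsub[OF bilinear_h] bilinear_rsub[OF bilinear_h]

lemma linear_h_left: "linear (\<lambda>x. h x y)"
  using bilinear_h by (simp add: bilinear_def)

lemma linear_h_right: "linear (h x)"
  using bilinear_h by (simp add: bilinear_def)

lemma h_sum_left: "h (sum f A) y = (\<Sum>a\<in>A. h (f a) y)"
  using linear_sum[OF linear_h_left] by simp

lemma h_sum_right: "h x (sum f A) = (\<Sum>a\<in>A. h x (f a))"
  using linear_sum[OF linear_h_right] by simp

lemma h_eqI: "(\<And>w. h x w = h y w) \<Longrightarrow> x = y"
proof -
  assume eq: "\<And>w. h x w = h y w"
  have "h (x - y) (x - y) = 0"
    using eq by (simp add: h_simps)
  then show "x = y"
    using inner unfolding inner_product_def by (metis eq_iff_diff_eq_0 less_irrefl)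
qed

text \<open>The right-hand side is linear in \<open>x\<close> and fixes every frame vector, so it is
  the identity on \<open>span E\<close>.\<close>

lemma frame_expansion: "x = (\<Sum>e\<in>E. h x e *\<^sub>R e)"
proof -
  define p where "p x = (\<Sum>e\<in>E. h x e *\<^sub>R e)" for x
  have lin: "linear p"
    unfolding p_def
    by (intro linear_compose_sum ballI) (auto intro!: linearI simp: h_simps algebra_simps)
  have "p x = x" for x
  proof (rule linear_eq_on_span[OF lin linear_ident])
    show "x \<in> span E"
      by (simp add: span_E)
  next
    fix f assume "f \<in> E"
    then have "p f = (\<Sum>e\<in>E. if e = f then e else 0)"
      unfolding p_def by (intro sum.cong) (auto simp: orthonormal)
    then show "p f = f"
      using \<open>f \<in> E\<close> finite_E by simp
  qed
  then show ?thesis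
    by (simp add: p_def)
qed

text \<open>Riesz representation with an explicit representing vector. It turns Koszul's expression
  into a connection and the Ricci form into an operator.\<close>

lemma riesz:
  assumes "linear f"
  shows "h (\<Sum>e\<in>E. f e *\<^sub>R e) w = f w"
proof -
  have "f w = (\<Sum>e\<in>E. h w e * f e)"
    by (subst frame_expansion[of w]) (simp add: linear_sum[OF assms] linear_scale[OF assms])
  then show ?thesis
    by (simp add: h_commute[of "sum _ _"] h_sum_right h_simps mult.commute)
qed

text \<open>Basis independence of the trace: expanding \<open>f b\<close> in the frame and
  interchanging the two sums reassembles each \<open>e\<close> from its coordinates in the basis
  \<open>B\<close>. That basis is finite, since an independent set is no larger than the finite
  spanning set \<open>E\<close>.\<close>

lemma lin_trace_eq:
  assumes "linear f"
  shows "lin_trace f = (\<Sum>e\<in>E. h (f e) e)"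
proof -
  define B :: "'a set" where "B = real_vector.extend_basis {}"
  have ind: "independent B" and span_B: "span B = UNIV"
    unfolding B_def by (simp_all add: real_vector.independent_extend_basis real_vector.span_extend_basis
          real_vector.independent_empty)
  have fin: "finite B"
    using independent_span_bound[OF finite_E ind] by (simp add: span_E)
  let ?r = "representation B"
  have r_sum: "?r (f b) b = (\<Sum>e\<in>E. h (f b) e * ?r e b)" for b
    by (subst frame_expansion[of "f b"])
      (simp add: representation_sum[OF ind] representation_scale[OF ind] span_B)
  have "lin_trace f = (\<Sum>b\<in>B. \<Sum>e\<in>E. h (f b) e * ?r e b)"
    unfolding lin_trace_def B_def[symmetric] by (simp add: r_sum)
  also have "\<dots> = (\<Sum>e\<in>E. h (f (\<Sum>b\<in>B. ?r e b *\<^sub>R b)) e)"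
    by (subst sum.swap) 
      (simp add: linear_sum[OF assms] linear_scale[OF assms] h_sum_left h_simps mult.commute)
  also have "\<dots> = (\<Sum>e\<in>E. h (f e) e)"
    by (simp add: sum_representation_eq[OF ind _ fin] span_B)
  finally show ?thesis .
qed

end

section \<open>The Levi-Civita connection of a left-invariant metric\<close>

locale metric_lie_algebra = orthonormal_frame h E
  for br :: "'a::real_vector \<Rightarrow> 'a \<Rightarrow> 'a" and h :: "'a \<Rightarrow> 'a \<Rightarrow> real" and E +
  assumes lie: "lie_algebra br"
begin

lemma bilinear_br: "bilinear br"
  using lie by (simp add: lie_algebra_def)

lemmas br_simps =
  bilinear_ladd[OF bilinear_br] bilinear_radd[OF bilinear_br]
  bilinear_lmul[OF bilinear_br] bilinear_rmul[OF bilinear_br]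
  bilinear_lneg[OF bilinear_br] bilinear_rneg[OF bilinear_br]
  bilinear_lzero[OF bilinear_br] bilinear_rzero[OF bilinear_br]
  bilinear_lsub[OF bilinear_br] bilinear_rsub[OF bilinear_br]

lemma br_self: "br x x = 0"
  using lie by (simp add: lie_algebra_def)

lemma br_anti: "br x y = - br y x"
proof -
  have "br x y + br y x = br (x + y) (x + y)"
    by (simp only: bilinear_ladd[OF bilinear_br] bilinear_radd[OF bilinear_br])
      (simp add: br_self)
  then show ?thesis
    by (simp only: eq_neg_iff_add_eq_0 br_self)
qed

text \<open>Right-hand side of Koszul's formula; the derivative terms are absent because inner
  products of left-invariant fields are constant.\<close>

definition koszul :: "'a \<Rightarrow> 'a \<Rightarrow> 'a \<Rightarrow> real" where
  "koszul u v w = (h (br u v) w - h (br v w) u + h (br w u) v) / 2"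

abbreviation nabla :: "'a \<Rightarrow> 'a \<Rightarrow> 'a" where
  "nabla \<equiv> levi_civita br h"

text \<open>Torsion-freeness writes each bracket in Koszul's expression as a difference of values of
  \<open>N\<close>. Of the six resulting terms, skew-symmetry of \<open>N\<close> cancels all but
  two equal ones.\<close>

lemma levi_civita_unique:
  assumes "\<forall>u v. N u v - N v u = br u v"
    and "\<forall>u v w. h (N u v) w + h v (N u w) = 0"
  shows "h (N u v) w = koszul u v w"
proof -
  have t: "h (br x y) z = h (N x y) z - h (N y x) z" for x y z
    using assms(1)[rule_format, of x y] by (metis h_simps(9))
  have m: "h (N x y) z + h (N x z) y = 0" for x y z
    using assms(2) by (metis h_commute)
  show ?thesis
    unfolding koszul_def t
    using m[of u v w] m[of v u w] m[of w u v] by simp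
qed

text \<open>The description by \<open>THE\<close> is usable only once existence and uniqueness are
  known. Uniqueness is Koszul's formula; for existence, the vectors representing Koszul's expression
  are checked to form a torsion-free metric connection.\<close>

lemma
  shows bilinear_nabla: "bilinear nabla"
    and nabla_metric: "h (nabla u v) w + h v (nabla u w) = 0"
    and nabla_koszul: "h (nabla u v) w = koszul u v w"
proof -
  let ?P = "\<lambda>N. bilinear N \<and> (\<forall>u v. N u v - N v u = br u v) \<and>
    (\<forall>u v w. h (N u v) w + h v (N u w) = 0)"
  define N where "N u v = (\<Sum>e\<in>E. koszul u v e *\<^sub>R e)" for u v
  have hN: "h (N u v) w = koszul u v w" for u v w
    unfolding N_def
    by (rule riesz) (auto intro!: linearI simp: koszul_def h_simps br_simps algebra_simps
        add_divide_distrib diff_divide_distrib)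
  have 1: "bilinear N"
    unfolding bilinear_def
    by (intro conjI allI linearI; rule h_eqI)
      (simp_all add: h_simps hN koszul_def br_simps algebra_simps add_divide_distrib diff_divide_distrib)
  have 2: "N u v - N v u = br u v" for u v
  proof (rule h_eqI)
    fix w
    \<comment> \<open>Antisymmetry is applied only to \<open>br v u\<close>, \<open>br w v\<close>
      and \<open>br u w\<close>, so that all brackets end up in the cyclic order of
      \<open>u\<close>, \<open>v\<close>, \<open>w\<close>.\<close>
    show "h (N u v - N v u) w = h (br u v) w"
      unfolding h_simps hN koszul_def br_anti[of v u] br_anti[of w v] br_anti[of u w] h_simps
      by (simp add: field_simps)
  qed
  have 3: "h (N u v) w + h v (N u w) = 0" for u v w
    unfolding h_commute[of v] hN koszul_def br_anti[of v u] br_anti[of w v] br_anti[of u w] h_simps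
    by (simp add: field_simps)
  have P: "?P N"
    using 1 2 3 by blast
  moreover have "M = N" if "?P M" for M
    using that levi_civita_unique[of M] by (intro ext h_eqI) (simp add: hN)
  ultimately have "?P nabla"
    unfolding levi_civita_def by (rule theI)
  then show "bilinear nabla"
    "h (nabla u v) w + h v (nabla u w) = 0" "h (nabla u v) w = koszul u v w"
    using levi_civita_unique[of nabla] by blast+
qed

lemmas nabla_simps =
  bilinear_ladd[OF bilinear_nabla] bilinear_radd[OF bilinear_nabla]
  bilinear_lmul[OF bilinear_nabla] bilinear_rmul[OF bilinear_nabla]
  bilinear_lneg[OF bilinear_nabla] bilinear_rneg[OF bilinear_nabla]
  bilinear_lzero[OF bilinear_nabla] bilinear_rzero[OF bilinear_nabla]
  bilinear_lsub[OF bilinear_nabla] bilinear_rsub[OF bilinear_nabla]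

section \<open>Ricci tensor and Ricci operator in a frame\<close>

text \<open>Metric compatibility moves the outer covariant derivative to the other argument of
  \<open>h\<close>. Ricci curvature is then computed from a table of single covariant derivatives,
  without iterating them.\<close>

lemma ricci_frame:
  "ricci br h u v =
    (\<Sum>e\<in>E. h (nabla e v) (nabla u e) - h (nabla u v) (nabla e e) - h (nabla (br e u) v) e)"
proof -
  have lin: "linear (\<lambda>w. riemann br h w u v)"
    by (rule linearI)
      (simp_all add: riemann_def Let_def nabla_simps br_simps algebra_simps)
  have m: "h (nabla x y) z = - h y (nabla x z)" for x y z
    using nabla_metric[of x y z] by simp
  have "h (riemann br h e u v) e =
      h (nabla e v) (nabla u e) - h (nabla u v) (nabla e e) - h (nabla (br e u) v) e" for e
    unfolding riemann_def Let_def h_simps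
    using m[of e "nabla u v" e] m[of u "nabla e v" e] by simp
  then show ?thesis
    unfolding ricci_def by (simp add: lin_trace_eq[OF lin])
qed

lemma bilinear_ricci: "bilinear (ricci br h)"
  unfolding bilinear_def
  by (intro conjI allI linearI)
    (simp_all add: ricci_frame nabla_simps br_simps h_simps algebra_simps
      sum.distrib sum_subtractf sum_distrib_left)

lemma ricci_operator_frame: "ricci_operator br h u = (\<Sum>e\<in>E. ricci br h u e *\<^sub>R e)"
proof -
  have lin: "linear (ricci br h u)"
    using bilinear_ricci by (simp add: bilinear_def)
  show ?thesis
    unfolding ricci_operator_def
  proof (rule the_equality)
    show "\<forall>v. ricci br h u v = h (\<Sum>e\<in>E. ricci br h u e *\<^sub>R e) v"
      by (simp only: riesz[OF lin] simp_thms)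
  next
    fix w assume "\<forall>v. ricci br h u v = h w v"
    then show "w = (\<Sum>e\<in>E. ricci br h u e *\<^sub>R e)"
      using frame_expansion[of w] by simp
  qed
qed

lemma linear_ricci_operator: "linear (ricci_operator br h)"
  by (rule linearI)
    (simp_all add: ricci_operator_frame bilinear_ladd[OF bilinear_ricci]
      bilinear_lmul[OF bilinear_ricci] algebra_simps sum.distrib scaleR_sum_right)

section \<open>Rescaling the metric\<close>

text \<open>The conditions defining the connection are homogeneous in the metric, so
  \<open>g\<close> and \<open>h\<close> share their connection and Ricci tensor. The factor \<eta>
  enters only when the Ricci form is converted to an operator.\<close>

lemma ricci_operator_scaled_metric:
  assumes "\<eta> \<noteq> 0" and h: "h = (\<lambda>x y. \<eta> * g x y)"
  shows "ricci_operator br g u = \<eta> *\<^sub>R ricci_operator br h u"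
proof -
  have "levi_civita br g = levi_civita br h"
    unfolding levi_civita_def h distrib_left[symmetric] using \<open>\<eta> \<noteq> 0\<close> by simp
  then have ric: "ricci br g = ricci br h"
    by (intro ext) (simp add: ricci_def riemann_def)
  have lin: "linear (ricci br h u)"
    using bilinear_ricci by (simp add: bilinear_def)
  have g: "g x y = h x y / \<eta>" for x y
    using assms by simp
  let ?w = "\<Sum>e\<in>E. ricci br h u e *\<^sub>R e"
  have "(THE w. \<forall>v. ricci br g u v = g w v) = \<eta> *\<^sub>R ?w"
  proof (rule the_equality)
    show "\<forall>v. ricci br g u v = g (\<eta> *\<^sub>R ?w) v"
      unfolding ric g h_simps riesz[OF lin] using \<open>\<eta> \<noteq> 0\<close> by simp
  next
    fix w assume "\<forall>v. ricci br g u v = g w v"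
    then have "h w v = \<eta> * ricci br h u v" for v
      using \<open>\<eta> \<noteq> 0\<close> by (simp add: ric g)
    then show "w = \<eta> *\<^sub>R ?w"
      by (intro h_eqI) (simp only: h_simps riesz[OF lin] real_scaleR_def)
  qed
  then show ?thesis
    by (simp add: ricci_operator_def ricci_operator_frame[unfolded ricci_operator_def])
qed

end

lemma lie_derivation_scale:
  assumes "lie_derivation br D" "bilinear br"
  shows "lie_derivation br (\<lambda>x. c *\<^sub>R D x)"
  using assms unfolding lie_derivation_def
  by (auto simp: linear_compose_scale_right bilinear_lmul bilinear_rmul scaleR_add_right)

lemma (in metric_lie_algebra) nilsoliton_scaled_metric:
  assumes "\<eta> \<noteq> 0" and h: "h = (\<lambda>x y. \<eta> * g x y)"
  shows "nilsoliton br g \<longleftrightarrow> nilsoliton br h"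
proof -
  note ric = ricci_operator_scaled_metric[OF assms]
  show ?thesis
  proof
    assume "nilsoliton br g"
    then obtain c D where D: "lie_derivation br D" 
      and eq: "\<And>u. \<eta> *\<^sub>R ricci_operator br h u = c *\<^sub>R u + D u"
      unfolding nilsoliton_def ric by blast
    have "ricci_operator br h u = (1/\<eta> * c) *\<^sub>R u + (1/\<eta>) *\<^sub>R D u" for u
      using arg_cong[OF eq[of u], of "\<lambda>x. (1/\<eta>) *\<^sub>R x"] \<open>\<eta> \<noteq> 0\<close>
      by (simp add: scaleR_add_right)
    then show "nilsoliton br h"
      unfolding nilsoliton_def using lie_derivation_scale[OF D bilinear_br] by blast
  next
    assume "nilsoliton br h"
    then obtain c D where D: "lie_derivation br D" 
      and eq: "\<And>u. ricci_operator br h u = c *\<^sub>R u + D u"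
      unfolding nilsoliton_def by blast
    have "ricci_operator br g u = (\<eta> * c) *\<^sub>R u + \<eta> *\<^sub>R D u" for u
      by (simp add: ric eq scaleR_add_right)
    then show "nilsoliton br g"
      unfolding nilsoliton_def using lie_derivation_scale[OF D bilinear_br] by blast
  qed
qed

section \<open>Connection and Ricci operator of the five-dimensional algebra\<close>

lemma atLeastAtMost_1_5: "{1..5} = {1, 2, 3, 4, 5::nat}"
  by auto

locale A53_frame =
  fixes br :: "'a::real_vector \<Rightarrow> 'a \<Rightarrow> 'a" and h :: "'a \<Rightarrow> 'a \<Rightarrow> real"
    and v :: "nat \<Rightarrow> 'a" and \<alpha> \<beta> \<gamma> \<delta> \<epsilon> :: real
  assumes lie_br: "lie_algebra br"
    and inner_h: "inner_product h"
    and basis_v: "is_basis5 v"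
    and orthonormal_v: "orthonormal5 h v"
    and brackets: "A53_brackets br v \<alpha> \<beta> \<gamma> \<delta> \<epsilon>"

sublocale A53_frame \<subseteq> metric_lie_algebra br h "v ` {1..5}"
proof
  \<comment> \<open>Injectivity of \<open>v\<close> translates equality of indices into equality of
    vectors.\<close>
  show "h e f = (if e = f then 1 else 0)" if "e \<in> v ` {1..5}" "f \<in> v ` {1..5}" for e f
    using that orthonormal_v basis_v by (auto simp: orthonormal5_def is_basis5_def inj_on_eq_iff)
qed (use lie_br inner_h basis_v in \<open>auto simp: is_basis5_def\<close>)

context A53_frame
begin

declare One_nat_def [simp del]

lemma sum_v: "(\<Sum>e\<in>v ` {1..5}. f e) = f (v 1) + f (v 2) + f (v 3) + f (v 4) + f (v 5)"
  for f :: "'a \<Rightarrow> 'b::comm_monoid_add"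
  using basis_v
  by (simp add: is_basis5_def sum.reindex) (simp add: atLeastAtMost_1_5 add.assoc)

lemma v_inner:
  assumes "i \<in> {1..5}" "j \<in> {1..5}"
  shows "h (v i) (v j) = (if i = j then 1 else 0)"
  using assms orthonormal_v by (simp add: orthonormal5_def)

lemma br_v:
  "br (v 1) (v 2) = \<alpha> *\<^sub>R v 3 + \<beta> *\<^sub>R v 4" "br (v 2) (v 1) = - (\<alpha> *\<^sub>R v 3) - \<beta> *\<^sub>R v 4"
  "br (v 1) (v 3) = \<gamma> *\<^sub>R v 4 + \<delta> *\<^sub>R v 5" "br (v 3) (v 1) = - (\<gamma> *\<^sub>R v 4) - \<delta> *\<^sub>R v 5"
  "br (v 2) (v 3) = \<epsilon> *\<^sub>R v 5" "br (v 3) (v 2) = - (\<epsilon> *\<^sub>R v 5)"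
  "br (v 1) (v 4) = 0" "br (v 1) (v 5) = 0" "br (v 2) (v 4) = 0" "br (v 2) (v 5) = 0"
  "br (v 3) (v 4) = 0" "br (v 3) (v 5) = 0" "br (v 4) (v 5) = 0"
  "br (v 4) (v 1) = 0" "br (v 5) (v 1) = 0" "br (v 4) (v 2) = 0" "br (v 5) (v 2) = 0"
  "br (v 4) (v 3) = 0" "br (v 5) (v 3) = 0" "br (v 5) (v 4) = 0"
  using brackets br_anti[of "v 2" "v 1"] br_anti[of "v 3" "v 1"] br_anti[of "v 3" "v 2"]
    br_anti[of "v 4" "v 1"] br_anti[of "v 4" "v 2"] br_anti[of "v 4" "v 3"]
    br_anti[of "v 5" "v 1"] br_anti[of "v 5" "v 2"] br_anti[of "v 5" "v 3"] br_anti[of "v 5" "v 4"]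
  by (simp_all add: A53_brackets_def)

lemma nabla_v_expansion:
  "nabla x y = koszul x y (v 1) *\<^sub>R v 1 + koszul x y (v 2) *\<^sub>R v 2 + koszul x y (v 3) *\<^sub>R v 3
    + koszul x y (v 4) *\<^sub>R v 4 + koszul x y (v 5) *\<^sub>R v 5"
  by (subst frame_expansion) (simp add: sum_v nabla_koszul)

lemma nabla_v:
  "nabla (v 1) (v 1) = 0"
  "nabla (v 1) (v 2) = (\<alpha>/2) *\<^sub>R v 3 + (\<beta>/2) *\<^sub>R v 4"
  "nabla (v 1) (v 3) = (-\<alpha>/2) *\<^sub>R v 2 + (\<gamma>/2) *\<^sub>R v 4 + (\<delta>/2) *\<^sub>R v 5"
  "nabla (v 1) (v 4) = (-\<beta>/2) *\<^sub>R v 2 + (-\<gamma>/2) *\<^sub>R v 3"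
  "nabla (v 1) (v 5) = (-\<delta>/2) *\<^sub>R v 3"
  "nabla (v 2) (v 1) = (-\<alpha>/2) *\<^sub>R v 3 + (-\<beta>/2) *\<^sub>R v 4"
  "nabla (v 2) (v 2) = 0"
  "nabla (v 2) (v 3) = (\<alpha>/2) *\<^sub>R v 1 + (\<epsilon>/2) *\<^sub>R v 5"
  "nabla (v 2) (v 4) = (\<beta>/2) *\<^sub>R v 1"
  "nabla (v 2) (v 5) = (-\<epsilon>/2) *\<^sub>R v 3"
  "nabla (v 3) (v 1) = (-\<alpha>/2) *\<^sub>R v 2 + (-\<gamma>/2) *\<^sub>R v 4 + (-\<delta>/2) *\<^sub>R v 5"
  "nabla (v 3) (v 2) = (\<alpha>/2) *\<^sub>R v 1 + (-\<epsilon>/2) *\<^sub>R v 5"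
  "nabla (v 3) (v 3) = 0"
  "nabla (v 3) (v 4) = (\<gamma>/2) *\<^sub>R v 1"
  "nabla (v 3) (v 5) = (\<delta>/2) *\<^sub>R v 1 + (\<epsilon>/2) *\<^sub>R v 2"
  "nabla (v 4) (v 1) = (-\<beta>/2) *\<^sub>R v 2 + (-\<gamma>/2) *\<^sub>R v 3"
  "nabla (v 4) (v 2) = (\<beta>/2) *\<^sub>R v 1"
  "nabla (v 4) (v 3) = (\<gamma>/2) *\<^sub>R v 1"
  "nabla (v 4) (v 4) = 0"
  "nabla (v 4) (v 5) = 0"
  "nabla (v 5) (v 1) = (-\<delta>/2) *\<^sub>R v 3"
  "nabla (v 5) (v 2) = (-\<epsilon>/2) *\<^sub>R v 3"
  "nabla (v 5) (v 3) = (\<delta>/2) *\<^sub>R v 1 + (\<epsilon>/2) *\<^sub>R v 2"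
  "nabla (v 5) (v 4) = 0"
  "nabla (v 5) (v 5) = 0"
  by (simp_all add: nabla_v_expansion koszul_def br_v br_self h_simps v_inner)

lemma ricci_operator_v:
  "ricci_operator br h (v 1) =
    (-(\<alpha>\<^sup>2+\<beta>\<^sup>2+\<gamma>\<^sup>2+\<delta>\<^sup>2)/2) *\<^sub>R v 1 + (-\<delta>*\<epsilon>/2) *\<^sub>R v 2"
  "ricci_operator br h (v 2) =
    (-\<delta>*\<epsilon>/2) *\<^sub>R v 1 + (-(\<alpha>\<^sup>2+\<beta>\<^sup>2+\<epsilon>\<^sup>2)/2) *\<^sub>R v 2 + (-\<beta>*\<gamma>/2) *\<^sub>R v 3"
  "ricci_operator br h (v 3) =
    (-\<beta>*\<gamma>/2) *\<^sub>R v 2 + ((\<alpha>\<^sup>2-\<gamma>\<^sup>2-\<delta>\<^sup>2-\<epsilon>\<^sup>2)/2) *\<^sub>R v 3 + (\<alpha>*\<beta>/2) *\<^sub>R v 4"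
  "ricci_operator br h (v 4) =
    (\<alpha>*\<beta>/2) *\<^sub>R v 3 + ((\<beta>\<^sup>2+\<gamma>\<^sup>2)/2) *\<^sub>R v 4 + (\<gamma>*\<delta>/2) *\<^sub>R v 5"
  "ricci_operator br h (v 5) = (\<gamma>*\<delta>/2) *\<^sub>R v 4 + ((\<delta>\<^sup>2+\<epsilon>\<^sup>2)/2) *\<^sub>R v 5"
  by (simp_all add: ricci_operator_frame ricci_frame sum_v nabla_v br_v br_self nabla_simps
      h_simps v_inner power2_eq_square field_simps)

text \<open>Every off-diagonal coefficient in \<open>ricci_operator_v\<close> has a factor \<beta>
  or \<delta>.\<close>

lemma ricci_operator_eigen:
  assumes "\<beta> = 0" "\<delta> = 0"
  shows "ricci_operator br h (v 1) = (-(\<alpha>\<^sup>2+\<gamma>\<^sup>2)/2) *\<^sub>R v 1"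
    "ricci_operator br h (v 2) = (-(\<alpha>\<^sup>2+\<epsilon>\<^sup>2)/2) *\<^sub>R v 2"
    "ricci_operator br h (v 3) = ((\<alpha>\<^sup>2-\<gamma>\<^sup>2-\<epsilon>\<^sup>2)/2) *\<^sub>R v 3"
    "ricci_operator br h (v 4) = (\<gamma>\<^sup>2/2) *\<^sub>R v 4"
    "ricci_operator br h (v 5) = (\<epsilon>\<^sup>2/2) *\<^sub>R v 5"
  using assms by (simp_all add: ricci_operator_v)

section \<open>Derivations and the soliton condition\<close>

text \<open>Both sides of the Leibniz rule are bilinear, so they agree everywhere once they agree on
  pairs of basis vectors.\<close>

lemma derivationI:
  assumes lin: "linear D"
    and D: "\<And>i j. i \<in> {1..5} \<Longrightarrow> j \<in> {1..5} \<Longrightarrow>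
      D (br (v i) (v j)) = br (D (v i)) (v j) + br (v i) (D (v j))"
  shows "lie_derivation br D"
proof -
  have bl: "bilinear (\<lambda>x y. D (br x y))"
    "bilinear (\<lambda>x y. br (D x) y + br x (D y))"
    unfolding bilinear_def
    by (auto intro!: linearI simp: br_simps linear_add[OF lin] linear_scale[OF lin] scaleR_add_right)
  have "D (br x y) = br (D x) y + br x (D y)" for x y
    by (rule bilinear_eq[OF bl, of UNIV "v ` {1..5}" UNIV "v ` {1..5}"]) (auto simp: D span_E)
  then show ?thesis
    using lin by (simp add: lie_derivation_def)
qed

theorem nilsoliton_iff:
  assumes pos: "\<alpha> > 0" "\<gamma> > 0" "\<epsilon> > 0"
  shows "nilsoliton br h \<longleftrightarrow> \<beta> = 0 \<and> \<delta> = 0 \<and> \<epsilon> = \<gamma> \<and> \<gamma> = sqrt 3 / 2 * \<alpha>"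
proof
  assume "nilsoliton br h"
  then obtain c D where der: "lie_derivation br D"
    and ric: "\<And>u. ricci_operator br h u = c *\<^sub>R u + D u"
    unfolding nilsoliton_def by blast
  have lin: "linear D" and D_br: "\<And>x y. D (br x y) = br (D x) y + br x (D y)"
    using der by (simp_all add: lie_derivation_def)
  note D_simps = linear_add[OF lin] linear_scale[OF lin] linear_0[OF lin]
  have D: "D u = ricci_operator br h u - c *\<^sub>R u" for u
    using ric by simp
  note compute = D ricci_operator_v br_simps br_v br_self h_simps v_inner
  have component: "h (D (br (v i) (v j))) (v k) = h (br (D (v i)) (v j)) (v k) + h (br (v i) (D (v j))) (v k)"
    for i j k
    by (simp add: D_br h_simps)
  \<comment> \<open>\<open>D (v 1)\<close> lies in the span of \<open>v 1\<close> and
    \<open>v 2\<close>, which commute with \<open>v 4\<close>. In \<open>D (v 4)\<close> only the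
    \<open>v 3\<close> term, with coefficient \<alpha>\<beta>/2, fails to commute with
    \<open>v 1\<close>. The equation reads \<alpha>\<beta>\<gamma>/2 = 0.\<close>
  have "\<beta> = 0"
    using component[of 1 4 4] pos by (simp add: br_v D_simps) (simp add: compute)
  \<comment> \<open>On the left, \<open>D (v 5)\<close> contributes \<gamma>\<delta>\<epsilon>/2; on
    the right, the \<open>v 1\<close> term of \<open>D (v 2)\<close> contributes the negative of
    this. Hence \<gamma>\<delta>\<epsilon> = 0.\<close>
  have "\<delta> = 0"
    using component[of 2 3 4] pos \<open>\<beta> = 0\<close> by (simp add: br_v D_simps) (simp add: compute)
  note eigen = ricci_operator_eigen[OF \<open>\<beta> = 0\<close> \<open>\<delta> = 0\<close>]
  define d where "d i = h (D (v i)) (v i)" for i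
  have d: "d 1 = -(\<alpha>\<^sup>2+\<gamma>\<^sup>2)/2 - c" "d 2 = -(\<alpha>\<^sup>2+\<epsilon>\<^sup>2)/2 - c"
    "d 3 = (\<alpha>\<^sup>2-\<gamma>\<^sup>2-\<epsilon>\<^sup>2)/2 - c" "d 4 = \<gamma>\<^sup>2/2 - c" "d 5 = \<epsilon>\<^sup>2/2 - c"
    by (simp_all add: d_def D eigen h_simps v_inner)
  have D_v: "D (v 1) = d 1 *\<^sub>R v 1" "D (v 2) = d 2 *\<^sub>R v 2" "D (v 3) = d 3 *\<^sub>R v 3"
    "D (v 4) = d 4 *\<^sub>R v 4" "D (v 5) = d 5 *\<^sub>R v 5"
    by (simp_all add: d D eigen scaleR_left_diff_distrib)
  note compute = D_v D_simps \<open>\<beta> = 0\<close> \<open>\<delta> = 0\<close> br_simps br_v h_simps v_inner algebra_simps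
  \<comment> \<open>For diagonal \<open>D\<close>, each nonzero bracket makes the weights additive,
    up to its structure constant, which positivity then cancels.\<close>
  have "\<alpha> * d 3 = \<alpha> * (d 1 + d 2)"
    using component[of 1 2 3] by (simp add: compute)
  moreover have "\<gamma> * d 4 = \<gamma> * (d 1 + d 3)"
    using component[of 1 3 4] by (simp add: compute)
  moreover have "\<epsilon> * d 5 = \<epsilon> * (d 2 + d 3)"
    using component[of 2 3 5] by (simp add: compute)
  ultimately have "d 3 = d 1 + d 2" "d 4 = d 1 + d 3" "d 5 = d 2 + d 3"
    using pos by (simp_all only: mult_cancel_left) auto
  \<comment> \<open>Eliminating \<open>c\<close> leaves two equations symmetric under exchanging
    \<gamma> and \<epsilon>. Their difference gives equality of the squares, and substituting back
    gives 4\<gamma>^2 = 3\<alpha>^2.\<close>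
  then have "\<gamma>\<^sup>2 = 3/4 * \<alpha>\<^sup>2" "\<epsilon>\<^sup>2 = \<gamma>\<^sup>2"
    unfolding d by (simp_all add: field_simps)
  then have "\<gamma>\<^sup>2 = (sqrt 3 / 2 * \<alpha>)\<^sup>2" "\<epsilon>\<^sup>2 = \<gamma>\<^sup>2"
    by (simp_all add: power_mult_distrib power_divide)
  then have "\<gamma> = sqrt 3 / 2 * \<alpha>" "\<epsilon> = \<gamma>"
    using pos by (simp_all add: power2_eq_iff_nonneg)
  then show "\<beta> = 0 \<and> \<delta> = 0 \<and> \<epsilon> = \<gamma> \<and> \<gamma> = sqrt 3 / 2 * \<alpha>"
    using \<open>\<beta> = 0\<close> \<open>\<delta> = 0\<close> by blast
next
  assume params: "\<beta> = 0 \<and> \<delta> = 0 \<and> \<epsilon> = \<gamma> \<and> \<gamma> = sqrt 3 / 2 * \<alpha>"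
  then have "\<gamma>\<^sup>2 = (sqrt 3 / 2 * \<alpha>)\<^sup>2"
    by metis
  then have sq: "\<gamma>\<^sup>2 = 3/4 * \<alpha>\<^sup>2"
    by (simp add: power_mult_distrib power_divide)
  \<comment> \<open>The value forced by additivity of the weights on the bracket of
    \<open>v 1\<close> and \<open>v 2\<close>.\<close>
  define c where "c = -3/2 * \<alpha>\<^sup>2"
  define D where "D u = ricci_operator br h u - c *\<^sub>R u" for u
  have lin: "linear D"
    unfolding D_def
    by (intro linear_compose_sub linear_ricci_operator linear_scale_self)
  \<comment> \<open>The weights are 5\<alpha>^2/8 times 1, 1, 2, 3, 3. Thus \<open>D\<close> is a
    multiple of the derivation that grades the algebra by bracket length, with \<open>v 1\<close>
    and \<open>v 2\<close> in degree 1.\<close>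
  have D_v: "D (v 1) = (5/8 * \<alpha>\<^sup>2) *\<^sub>R v 1" "D (v 2) = (5/8 * \<alpha>\<^sup>2) *\<^sub>R v 2"
    "D (v 3) = (5/4 * \<alpha>\<^sup>2) *\<^sub>R v 3"
    "D (v 4) = (15/8 * \<alpha>\<^sup>2) *\<^sub>R v 4" "D (v 5) = (15/8 * \<alpha>\<^sup>2) *\<^sub>R v 5"
    using params by (simp_all add: D_def c_def ricci_operator_eigen sq
        flip: scaleR_left_diff_distrib scaleR_left_distrib)
  have "lie_derivation br D"
  proof (rule derivationI[OF lin])
    fix i j :: nat
    assume "i \<in> {1..5}" "j \<in> {1..5}"
    then show "D (br (v i) (v j)) = br (D (v i)) (v j) + br (v i) (D (v j))"
      using params unfolding atLeastAtMost_1_5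
      by (auto simp: br_v br_self br_simps linear_scale[OF lin] linear_0[OF lin] linear_neg[OF lin]
          D_v algebra_simps simp flip: scaleR_left_distrib)
  qed
  then show "nilsoliton br h"
    unfolding nilsoliton_def by (intro exI[of _ c] exI[of _ D]) (simp add: D_def)
qed

end

theorem corollary6:
  fixes br :: "'a::real_vector \<Rightarrow> 'a \<Rightarrow> 'a"
    and g :: "'a \<Rightarrow> 'a \<Rightarrow> real"
    and v :: "nat \<Rightarrow> 'a"
    and \<eta> \<alpha> \<beta> \<gamma> \<delta> \<epsilon> :: real
  assumes "is_A53 br"
    and "inner_product g"
    and "\<eta> > 0"
    and "is_basis5 v"
    and "orthonormal5 (\<lambda>x y. \<eta> * g x y) v"
    and "\<alpha> > 0" and "\<gamma> > 0" and "\<epsilon> > 0"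
    and "A53_brackets br v \<alpha> \<beta> \<gamma> \<delta> \<epsilon>"
  shows "nilsoliton br g \<longleftrightarrow>
    \<beta> = 0 \<and> \<delta> = 0 \<and> \<epsilon> = \<gamma> \<and> \<gamma> = sqrt 3 / 2 * \<alpha>"
proof -
  interpret A53_frame br "\<lambda>x y. \<eta> * g x y" v \<alpha> \<beta> \<gamma> \<delta> \<epsilon>
  proof
    show "lie_algebra br"
      using \<open>is_A53 br\<close> by (simp add: is_A53_def)
    show "inner_product (\<lambda>x y. \<eta> * g x y)"
      using \<open>inner_product g\<close> \<open>\<eta> > 0\<close>
      by (auto simp: inner_product_def bilinear_def linear_iff algebra_simps)
  qed fact+
  show ?thesis
    using nilsoliton_scaled_metric[of \<eta> g] nilsoliton_iff assms by simp
qed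

end
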